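(* Let $p\in\mathbb{N}$ be fixed. For each $f\in C^*_\rho[0,\infty)$, $$\lim_{n\to\infty}\|\mathcal{L}_{n,p}(f)-f\|_\rho=0.$$
   Context: $\mathbb{N}$ denotes the positive integers. For $n,p\in\mathbb{N}$ and suitable $f:[0,\infty)\to\mathbb{R}$, the Baskakov-Schurer-Szász operator is $$\mathcal{L}_{n,p}(f,x)=(n+p)\sum_{k=0}^{\infty}b^k_{n,p}(x)\int_0^\infty f(t)\,s^k_{n,p}(t)\,dt,\qquad x\in[0,\infty),$$ where $b^k_{n,p}(x)=\binom{n+p+k-1}{k}\frac{x^k}{(1+x)^{n+p+k}}$ and $s^k_{n,p}(t)=e^{-(n+p)t}\frac{((n+p)t)^k}{k!}$; $\mathcal{L}_{n,p}(f)$ denotes the function $x\mapsto\mathcal{L}_{n,p}(f,x)$. Let $\rho(x)=1+x^2$. $C_\rho[0,\infty)$ is the space of continuous $f:[0,\infty)\to\mathbb{R}$ for which there is a constant $M_f$ with $|f(x)|\le M_f\,\rho(x)$ for all $x\ge0$. $C^*_\rho[0,\infty)$ is the subspace of those $f\in C_\rho[0,\infty)$ for which $\lim_{x\to\infty}f(x)/\rho(x)$ exists and is finite. The norm is $\|f\|_\rho=\sup_{x\in[0,\infty)}\frac{|f(x)|}{1+x^2}$. *)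

theory Defs
  imports "HOL-Analysis.Analysis"
begin

text \<open>Functions on the half-line are represented by total functions on the reals; only their
  values on \<open>{0..}\<close> are used. The parameters \<open>n\<close> and \<open>p\<close> are meant to be positive, so that the
  natural-number subtraction below does not truncate.\<close>

definition baskakov_basis :: "nat \<Rightarrow> nat \<Rightarrow> nat \<Rightarrow> real \<Rightarrow> real" where
  "baskakov_basis n p k x = real ((n + p + k - 1) choose k) * (x ^ k / (1 + x) ^ (n + p + k))"

definition szasz_basis :: "nat \<Rightarrow> nat \<Rightarrow> nat \<Rightarrow> real \<Rightarrow> real" where
  "szasz_basis n p k t = exp (- (real (n + p) * t)) * ((real (n + p) * t) ^ k / fact k)"

definition bss_operator :: "nat \<Rightarrow> nat \<Rightarrow> (real \<Rightarrow> real) \<Rightarrow> real \<Rightarrow> real" where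
  "bss_operator n p f x =
     real (n + p) * (\<Sum>k. baskakov_basis n p k x * (LBINT t:{0..}. f t * szasz_basis n p k t))"

definition rho :: "real \<Rightarrow> real" where
  "rho x = 1 + x\<^sup>2"

definition C_rho :: "(real \<Rightarrow> real) set" where
  "C_rho = {f. continuous_on {0..} f \<and> (\<exists>M. \<forall>x\<ge>0. \<bar>f x\<bar> \<le> M * rho x)}"

definition C_rho_star :: "(real \<Rightarrow> real) set" where
  "C_rho_star = {f \<in> C_rho. \<exists>l. ((\<lambda>x. f x / rho x) \<longlongrightarrow> l) at_top}"

text \<open>The supremum is meaningful only if the quotient is bounded on \<open>{0..}\<close>; the value for an
  unbounded quotient is unspecified.\<close>

definition rho_norm :: "(real \<Rightarrow> real) \<Rightarrow> real" where
  "rho_norm f = (SUP x\<in>{0..}. \<bar>f x\<bar> / (1 + x\<^sup>2))"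

end

theory Submission
  imports Defs "HOL-Probability.Distributions"
begin

text \<open>
  The result is a weighted Korovkin theorem for a positive linear operator. The Baskakov weights form
  the negative binomial distribution of the number \<open>k\<close> of failures, and \<open>n + p\<close> times the \<open>k\<close>-th
  Szasz function is the Erlang density with shape \<open>k + 1\<close> and rate \<open>n + p\<close>. So the operator at \<open>x\<close> is
  an expectation under a mixture of Erlang laws, and its moments are explicit. With \<open>m = n + p\<close>, it
  sends \<open>1\<close> to \<open>1\<close>, \<open>t\<close> to \<open>x + 1/m\<close>, and \<open>t\<^sup>2\<close> to \<open>x\<^sup>2 + (x\<^sup>2 + 4x)/m + 2/m\<^sup>2\<close>. Hence the mean of
  \<open>(t - x)\<^sup>2\<close> is \<open>(x\<^sup>2 + 2x)/m + 2/m\<^sup>2 \<le> 4 \<rho>(x)/m\<close>, which is small relative to the weight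
  uniformly in \<open>x\<close> (\<open>bss_operator_quadratic\<close>).

  Let \<open>l\<close> be the limit of \<open>f / \<rho>\<close>. Then \<open>g = f - l \<rho>\<close> is negligible against \<open>\<rho>\<close> at infinity and
  uniformly continuous on compact sets. For each \<open>\<epsilon> > 0\<close> this gives a constant \<open>C\<close> such that, for all
  \<open>x, t \<ge> 0\<close>,
  \<open>\<bar>g(t) - g(x)\<bar> \<le> \<epsilon> (\<rho>(t) + \<rho>(x)) + C (t - x)\<^sup>2\<close> (\<open>rho_small_oscillation_bound\<close>).
  In terms of \<open>f\<close>, with \<open>x\<close> fixed, this bounds the distance from \<open>f\<close> to the quadratic polynomial
  \<open>f(x) + l (t\<^sup>2 - x\<^sup>2)\<close> by another quadratic polynomial in \<open>t\<close>. By positivity the same bound holds after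
  applying the operator (\<open>bss_operator_quadratic_comparison\<close>), where both quadratics have explicit
  images. Writing \<open>L\<close> for the operator, the outcome is
  \<open>\<bar>L f(x) - f(x)\<bar> \<le> (7 \<epsilon> + (5 \<bar>l\<bar> + 4 C)/m) \<rho>(x)\<close> (\<open>bss_operator_approximation_bound\<close>), and the
  theorem follows by choosing \<open>\<epsilon>\<close> first and \<open>n\<close> afterwards.
\<close>

section \<open>Moments of the Baskakov weights\<close>

lemma baskakov_basis_nonneg: "0 \<le> x \<Longrightarrow> 0 \<le> baskakov_basis n p k x"
  by (simp add: baskakov_basis_def)

text \<open>With \<open>y = x / (1 + x)\<close> this is Newton's series for \<open>(1 - y)\<close> to the power \<open>- (n + p)\<close>, in which
  the signs of the generalised binomial coefficients and of \<open>(- y) ^ k\<close> cancel.\<close>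

lemma baskakov_basis_sums_one:
  assumes "0 < n + p" and x: "0 \<le> x"
  shows "(\<lambda>k. baskakov_basis n p k x) sums 1"
proof -
  define m where "m = n + p"
  define y where "y = x / (1 + x)"
  have m: "0 < m" using assms by (simp add: m_def)
  have y: "\<bar>- y\<bar> < 1" and y1: "1 - y = 1 / (1 + x)"
    using x by (auto simp: y_def field_simps)
  have coeff: "(- real m gchoose k) * (- y) ^ k = real ((m + k - 1) choose k) * y ^ k" for k
  proof -
    have "(- real m gchoose k) = (-1) ^ k * real ((m + k - 1) choose k)"
      using m by (simp add: gbinomial_minus binomial_gbinomial of_nat_diff)
    moreover have "(- y) ^ k = (-1) ^ k * y ^ k"
      by (rule power_minus)
    moreover have "(-1) ^ k * (-1) ^ k = (1::real)"
      by (simp flip: power_mult_distrib)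
    ultimately show ?thesis by (simp add: mult_ac)
  qed
  have "(\<lambda>k. real ((m + k - 1) choose k) * y ^ k) sums (1 - y) powr (- real m)"
    using gen_binomial_real[OF y, of "- real m"] by (simp add: coeff)
  also have "(1 - y) powr (- real m) = (1 + x) ^ m"
    using x by (simp add: y1 powr_minus powr_realpow power_one_over)
  finally have "(\<lambda>k. real ((m + k - 1) choose k) * y ^ k / (1 + x) ^ m) sums ((1 + x) ^ m / (1 + x) ^ m)"
    by (rule sums_divide)
  then show ?thesis
    using x by (simp add: baskakov_basis_def m_def y_def power_divide power_add mult_ac)
qed

text \<open>A factor \<open>k\<close> shifts the weights to the next parameter. Each factorial moment thereby reduces to a
  lower one with \<open>n + 1\<close> in place of \<open>n\<close>, so that no further series has to be summed.\<close>

lemma baskakov_basis_Suc: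
  assumes "0 < n + p" and "0 \<le> x"
  shows "real (Suc k) * baskakov_basis n p (Suc k) x
           = real (n + p) * x * baskakov_basis (Suc n) p k x"
proof -
  have e1: "n + p + Suc k - 1 = n + p + k" by simp
  have e2: "Suc n + p + k - 1 = n + p + k" by simp
  have "Suc k * ((n + p + k) choose Suc k) = (n + p) * ((n + p + k) choose k)"
    using binomial_absorb_comp[of "n + p + k" k] binomial_absorption[of k "n + p + k"]
    by simp
  from arg_cong[OF this, of real]
  have "real (Suc k) * real ((n + p + k) choose Suc k)
          = real (n + p) * real ((n + p + k) choose k)"
    by (simp only: of_nat_mult)
  then have "real (Suc k) * real ((n + p + k) choose Suc k) * (x ^ Suc k / (1 + x) ^ (n + p + Suc k))
     = real (n + p) * real ((n + p + k) choose k) * (x * (x ^ k / (1 + x) ^ (Suc n + p + k)))"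
    by (simp only: power_Suc times_divide_eq_right add_Suc add_Suc_right)
  then show ?thesis
    unfolding baskakov_basis_def e1 e2 by (simp only: mult_ac)
qed

lemma baskakov_basis_mean:
  assumes "0 < n + p" and "0 \<le> x"
  shows "(\<lambda>k. real k * baskakov_basis n p k x) sums (real (n + p) * x)"
proof -
  have "(\<lambda>k. real (Suc k) * baskakov_basis n p (Suc k) x) sums (real (n + p) * x * 1)"
    unfolding baskakov_basis_Suc[OF assms]
    by (intro sums_mult baskakov_basis_sums_one) (use assms in auto)
  then show ?thesis by (subst (asm) sums_Suc_iff) simp
qed

lemma baskakov_basis_second_factorial_moment:
  assumes "0 < n + p" and "0 \<le> x"
  shows "(\<lambda>k. real k * (real k - 1) * baskakov_basis n p k x)
           sums (real (n + p) * (real (n + p) + 1) * x\<^sup>2)"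
proof -
  have eq: "real (Suc k) * (real (Suc k) - 1) * baskakov_basis n p (Suc k) x
          = real (n + p) * x * (real k * baskakov_basis (Suc n) p k x)" for k
    using baskakov_basis_Suc[OF assms, of k] by (simp add: mult_ac)
  have "(\<lambda>k. real (Suc k) * (real (Suc k) - 1) * baskakov_basis n p (Suc k) x)
     sums (real (n + p) * x * (real (Suc n + p) * x))"
    unfolding eq by (intro sums_mult baskakov_basis_mean) (use assms in auto)
  then have "(\<lambda>k. real k * (real k - 1) * baskakov_basis n p k x)
     sums (real (n + p) * x * (real (Suc n + p) * x))"
    by (subst (asm) sums_Suc_iff) simp
  then show ?thesis by (simp add: power2_eq_square algebra_simps)
qed

section \<open>Integrals against the Szasz functions\<close>

lemma szasz_basis_nonneg: "0 \<le> t \<Longrightarrow> 0 \<le> szasz_basis n p k t"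
  by (simp add: szasz_basis_def)

text \<open>Up to the factor \<open>n + p\<close> the integrand is \<open>t ^ i\<close> times an Erlang density, so the value is an Erlang
  moment.\<close>

lemma szasz_basis_moment:
  assumes m: "0 < n + p"
  shows "has_bochner_integral lborel (\<lambda>t. indicator {0..} t *\<^sub>R (t ^ i * szasz_basis n p k t))
           (fact (k + i) / (fact k * real (n + p) ^ (i + 1)))"
proof -
  define l where "l = real (n + p)"
  have l: "0 < l" using m by (simp add: l_def del: of_nat_add)
  have "has_bochner_integral lborel (\<lambda>t. erlang_density k l t * t ^ i) (fact (k + i) / (fact k * l ^ i))"
    using l nn_integral_erlang_ith_moment[OF l, of k i]
    by (intro has_bochner_integral_nn_integral AE_I2)
       (auto simp: erlang_density_def)
  then have "has_bochner_integral lborel (\<lambda>t. erlang_density k l t * t ^ i / l)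
               (fact (k + i) / (fact k * l ^ i) / l)"
    by (rule has_bochner_integral_divide_zero)
  moreover have "erlang_density k l t * t ^ i / l
      = indicator {0..} t *\<^sub>R (t ^ i * szasz_basis n p k t)" for t
    using l unfolding szasz_basis_def l_def[symmetric]
    by (auto simp: erlang_density_def power_mult_distrib)
  ultimately show ?thesis by (simp add: l_def mult_ac)
qed

lemma szasz_integrable_power:
  assumes "0 < n + p"
  shows "set_integrable lborel {0..} (\<lambda>t. t ^ i * szasz_basis n p k t)"
  using szasz_basis_moment[OF assms] unfolding set_integrable_def integrable.simps by blast

lemma szasz_integral_power:
  assumes "0 < n + p"
  shows "(LBINT t:{0..}. t ^ i * szasz_basis n p k t)
           = fact (k + i) / (fact k * real (n + p) ^ (i + 1))"
  using szasz_basis_moment[OF assms] unfolding set_lebesgue_integral_def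
  by (rule has_bochner_integral_integral_eq)

lemma szasz_integral_quadratic:
  fixes a b c :: real
  assumes m: "0 < n + p"
  shows "set_integrable lborel {0..} (\<lambda>t. (a + b * t + c * t\<^sup>2) * szasz_basis n p k t)" (is ?int)
    and "real (n + p) * (LBINT t:{0..}. (a + b * t + c * t\<^sup>2) * szasz_basis n p k t)
           = a + b * (real k + 1) / real (n + p)
               + c * ((real k + 1) * (real k + 2)) / (real (n + p))\<^sup>2" (is ?val)
proof -
  let ?s = "szasz_basis n p k"
  define l where "l = real (n + p)"
  have l: "0 < l" using m by (simp add: l_def del: of_nat_add)
  define e where "e = (\<lambda>i t. t ^ i * ?s t)"
  have int: "set_integrable lborel {0..} (e i)" for i
    unfolding e_def by (rule szasz_integrable_power[OF m])
  have val: "(LBINT t:{0..}. e i t) = fact (k + i) / (fact k * l ^ (i + 1))" for i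
    unfolding e_def l_def by (rule szasz_integral_power[OF m])
  have eq: "(\<lambda>t. (a + b * t + c * t\<^sup>2) * ?s t) = (\<lambda>t. a * e 0 t + b * e 1 t + c * e 2 t)"
    by (auto simp: e_def algebra_simps)
  have fact2: "fact (k + 2) = (real k + 1) * (real k + 2) * fact k"
    by (simp add: numeral_2_eq_2 algebra_simps)
  show ?int unfolding eq by (intro set_integral_add set_integrable_mult_right int)
  have int_eq: "(LBINT t:{0..}. (a + b * t + c * t\<^sup>2) * ?s t)
      = a / l + b * (real k + 1) / l ^ 2 + c * ((real k + 1) * (real k + 2)) / l ^ 3"
  proof -
    have "(LBINT t:{0..}. (a + b * t + c * t\<^sup>2) * ?s t)
        = a * (fact (k + 0) / (fact k * l ^ (0 + 1))) + b * (fact (k + 1) / (fact k * l ^ (1 + 1)))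
          + c * (fact (k + 2) / (fact k * l ^ (2 + 1)))"
      unfolding eq val[symmetric] by (simp add: set_integral_add int)
    also have "\<dots> = a / l + b * (real k + 1) / l ^ 2 + c * ((real k + 1) * (real k + 2)) / l ^ 3"
      unfolding fact2 by (simp add: numeral_3_eq_3 power2_eq_square)
    finally show ?thesis .
  qed
  show ?val
    unfolding l_def[symmetric] int_eq using l by (simp add: field_simps power2_eq_square power3_eq_cube)
qed

section \<open>The operator on quadratic polynomials\<close>

text \<open>The integral is quadratic in \<open>k\<close>. Written in terms of \<open>1\<close>, \<open>k\<close> and \<open>k (k - 1)\<close>, it can be summed with
  the factorial moments of the weights. Convergence, and not just the value of the sum, matters
  for later comparisons.\<close>

lemma bss_sums_quadratic:
  fixes a b c :: real
  assumes m: "0 < n + p" and x: "0 \<le> x"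
  shows "(\<lambda>k. baskakov_basis n p k x *
              (LBINT t:{0..}. (a + b * t + c * t\<^sup>2) * szasz_basis n p k t))
           sums ((a + b * (x + 1 / real (n + p))
                  + c * (x\<^sup>2 + x\<^sup>2 / real (n + p) + 4 * x / real (n + p) + 2 / (real (n + p))\<^sup>2))
                 / real (n + p))"
proof -
  define l where "l = real (n + p)"
  have l: "0 < l" using m by (simp add: l_def del: of_nat_add)
  let ?b = "\<lambda>k. baskakov_basis n p k x"
  have "(\<lambda>k. (a / l + b / l\<^sup>2 + 2 * c / l ^ 3) * ?b k
            + (b / l\<^sup>2 + 4 * c / l ^ 3) * (real k * ?b k)
            + c / l ^ 3 * (real k * (real k - 1) * ?b k))
        sums ((a / l + b / l\<^sup>2 + 2 * c / l ^ 3) * 1 + (b / l\<^sup>2 + 4 * c / l ^ 3) * (l * x)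
              + c / l ^ 3 * (l * (l + 1) * x\<^sup>2))" (is "?f sums ?S")
    unfolding l_def
    by (intro sums_add sums_mult baskakov_basis_sums_one baskakov_basis_mean
        baskakov_basis_second_factorial_moment m x)
  moreover have "?f k = ?b k * (LBINT t:{0..}. (a + b * t + c * t\<^sup>2) * szasz_basis n p k t)" for k
  proof -
    have "(LBINT t:{0..}. (a + b * t + c * t\<^sup>2) * szasz_basis n p k t)
        = (a + b * (real k + 1) / l + c * ((real k + 1) * (real k + 2)) / l\<^sup>2) / l"
      using szasz_integral_quadratic(2)[OF m, of a b c k] l
      unfolding l_def by (simp add: field_simps del: of_nat_add)
    also have "\<dots> = (a / l + b / l\<^sup>2 + 2 * c / l ^ 3) + (b / l\<^sup>2 + 4 * c / l ^ 3) * real k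
            + c / l ^ 3 * (real k * (real k - 1))"
      using l by (simp add: field_simps power2_eq_square power3_eq_cube)
    finally show ?thesis by (simp add: algebra_simps)
  qed
  moreover have "?S = (a + b * (x + 1 / l) + c * (x\<^sup>2 + x\<^sup>2 / l + 4 * x / l + 2 / l\<^sup>2)) / l"
    using l by (simp add: field_simps power2_eq_square power3_eq_cube)
  ultimately show ?thesis by (simp add: l_def)
qed

lemma bss_operator_quadratic:
  fixes a b c :: real
  assumes "0 < n + p" and "0 \<le> x"
  shows "bss_operator n p (\<lambda>t. a + b * t + c * t\<^sup>2) x
           = a + b * (x + 1 / real (n + p))
               + c * (x\<^sup>2 + x\<^sup>2 / real (n + p) + 4 * x / real (n + p) + 2 / (real (n + p))\<^sup>2)"
  unfolding bss_operator_def sums_unique[OF bss_sums_quadratic[OF assms], symmetric]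
  using assms by (simp del: of_nat_add)

section \<open>Positivity\<close>

text \<open>Linearity and positivity of the operator in the one form that the argument uses. The
  domination by a quadratic supplies the integrability and summability that splitting \<open>f\<close>
  into the polynomial and the difference requires.\<close>

lemma bss_operator_quadratic_comparison:
  fixes f :: "real \<Rightarrow> real" and a b c a' b' c' :: real
  assumes m: "0 < n + p" and x: "0 \<le> x"
    and cont: "continuous_on {0..} f"
    and le: "\<And>t. 0 \<le> t \<Longrightarrow> \<bar>f t - (a + b * t + c * t\<^sup>2)\<bar> \<le> a' + b' * t + c' * t\<^sup>2"
  shows "\<bar>bss_operator n p f x - bss_operator n p (\<lambda>t. a + b * t + c * t\<^sup>2) x\<bar>
           \<le> bss_operator n p (\<lambda>t. a' + b' * t + c' * t\<^sup>2) x"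
proof -
  define q where "q = (\<lambda>t::real. a + b * t + c * t\<^sup>2)"
  define h where "h = (\<lambda>t::real. a' + b' * t + c' * t\<^sup>2)"
  define I where "I = (\<lambda>g k. LBINT t:{0..}. g t * szasz_basis n p k t)"
  let ?b = "\<lambda>k. baskakov_basis n p k x" and ?s = "szasz_basis n p"
  have q_int: "set_integrable lborel {0..} (\<lambda>t. q t * ?s k t)" for k
    unfolding q_def by (rule szasz_integral_quadratic(1)[OF m])
  have h_int: "set_integrable lborel {0..} (\<lambda>t. h t * ?s k t)" for k
    unfolding h_def by (rule szasz_integral_quadratic(1)[OF m])
  have q_sum: "summable (\<lambda>k. ?b k * I q k)" and h_sum: "summable (\<lambda>k. ?b k * I h k)"
    unfolding I_def q_def h_def using bss_sums_quadratic[OF m x] sums_summable by blast+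
  have diff_int: "set_integrable lborel {0..} (\<lambda>t. (f t - q t) * ?s k t)" for k
  proof (rule set_integrable_bound[OF h_int[of k]])
    have "continuous_on {0..} (\<lambda>t. (f t - q t) * ?s k t)"
      unfolding q_def szasz_basis_def by (intro continuous_intros cont) auto
    then show "set_borel_measurable lborel {0..} (\<lambda>t. (f t - q t) * ?s k t)"
      unfolding set_borel_measurable_def
      by (simp add: borel_measurable_continuous_on_indicator del: real_scaleR_def)
    have "norm ((f t - q t) * ?s k t) \<le> norm (h t * ?s k t)" if "0 \<le> t" for t
      using le[OF that] szasz_basis_nonneg[OF that, of n p k]
      by (auto simp: abs_mult q_def h_def intro!: mult_right_mono)
    then show "AE t in lborel. t \<in> {0..} \<longrightarrow> norm ((f t - q t) * ?s k t) \<le> norm (h t * ?s k t)"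
      by simp
  qed
  have bss: "bss_operator n p g x = real (n + p) * (\<Sum>k. ?b k * I g k)" for g
    by (simp add: bss_operator_def I_def)
  have f_eq: "I f k = I q k + I (\<lambda>t. f t - q t) k" for k
    unfolding I_def
    by (subst set_integral_add(2)[OF q_int diff_int, symmetric]) (simp add: algebra_simps)
  have diff_le: "\<bar>I (\<lambda>t. f t - q t) k\<bar> \<le> I h k" for k
  proof (rule abs_leI)
    have bnd: "(f t - q t) * ?s k t \<le> h t * ?s k t" "- ((f t - q t) * ?s k t) \<le> h t * ?s k t"
      if "0 \<le> t" for t
      using le[OF that] szasz_basis_nonneg[OF that, of n p k]
      by (auto simp: q_def h_def minus_mult_left simp del: mult_minus_left intro!: mult_right_mono)
    show "I (\<lambda>t. f t - q t) k \<le> I h k"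
      unfolding I_def by (intro set_integral_mono diff_int h_int bnd) auto
    have "set_integrable lborel {0..} (\<lambda>t. - ((f t - q t) * ?s k t))"
      using set_integrable_mult_right[of "-1", OF diff_int] by simp
    then show "- I (\<lambda>t. f t - q t) k \<le> I h k"
      unfolding I_def by (subst set_integral_uminus[OF diff_int, symmetric])
        (intro set_integral_mono h_int bnd, auto)
  qed
  have term_le: "norm (?b k * I (\<lambda>t. f t - q t) k) \<le> ?b k * I h k" for k
    using diff_le[of k] baskakov_basis_nonneg[OF x, of n p k]
    by (auto simp: abs_mult intro!: mult_left_mono)
  have diff_sum: "summable (\<lambda>k. ?b k * I (\<lambda>t. f t - q t) k)"
    by (rule summable_comparison_test'[OF h_sum term_le])
  have "bss_operator n p f x - bss_operator n p q x
      = real (n + p) * (\<Sum>k. ?b k * I (\<lambda>t. f t - q t) k)"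
    unfolding bss f_eq distrib_left suminf_add[OF q_sum diff_sum, symmetric]
    by (simp add: algebra_simps)
  moreover have "\<bar>\<Sum>k. ?b k * I (\<lambda>t. f t - q t) k\<bar> \<le> (\<Sum>k. ?b k * I h k)"
    using norm_suminf_le[OF term_le h_sum] by simp
  ultimately have "\<bar>bss_operator n p f x - bss_operator n p q x\<bar>
      \<le> real (n + p) * (\<Sum>k. ?b k * I h k)"
    by (auto simp: abs_mult intro!: mult_left_mono)
  then show ?thesis unfolding bss[symmetric] by (simp add: q_def h_def)
qed

section \<open>The oscillation of a function that is negligible against the weight\<close>

text \<open>For distant points, the square term absorbs any constant. For close points, either both
  lie in the tail, where \<open>g\<close> itself is at most \<open>\<epsilon> \<rho>\<close>, or both lie in a compact interval, where
  \<open>g\<close> is uniformly continuous and \<open>\<epsilon> \<le> \<epsilon> \<rho>\<close>.\<close>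

lemma rho_small_oscillation_bound:
  fixes g :: "real \<Rightarrow> real"
  assumes cont: "continuous_on {0..} g"
    and lim: "((\<lambda>t. g t / rho t) \<longlongrightarrow> 0) at_top" and \<epsilon>: "0 < \<epsilon>"
  obtains C where "0 \<le> C"
    and "\<And>x t. 0 \<le> x \<Longrightarrow> 0 \<le> t \<Longrightarrow> \<bar>g t - g x\<bar> \<le> \<epsilon> * (rho t + rho x) + C * (t - x)\<^sup>2"
proof -
  have rho: "1 \<le> rho t" for t by (simp add: rho_def)
  have "\<forall>\<^sub>F t in at_top. \<bar>g t / rho t\<bar> < \<epsilon>"
    using tendstoD[OF lim \<epsilon>] by simp
  then obtain A0 where A0: "\<bar>g t / rho t\<bar> < \<epsilon>" if "A0 \<le> t" for t
    by (auto simp: eventually_at_top_linorder)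
  define A where "A = max A0 0"
  have tail: "\<bar>g t\<bar> \<le> \<epsilon> * rho t" if "A \<le> t" for t
    using A0[of t] that rho[of t] by (auto simp: A_def abs_divide divide_simps split: if_splits)
  have cont': "continuous_on {0..A+1} g"
    using cont by (rule continuous_on_subset) auto
  have "bounded (g ` {0..A+1})"
    by (intro compact_imp_bounded compact_continuous_image cont') auto
  then obtain M where M: "0 < M" "\<And>t. t \<in> {0..A+1} \<Longrightarrow> \<bar>g t\<bar> \<le> M"
    unfolding bounded_pos by auto
  have "uniformly_continuous_on {0..A+1} g"
    by (intro compact_uniformly_continuous cont') auto
  then obtain \<delta>0 where \<delta>0: "0 < \<delta>0"
    "\<And>x t. \<lbrakk>x \<in> {0..A+1}; t \<in> {0..A+1}; dist t x < \<delta>0\<rbrakk> \<Longrightarrow> dist (g t) (g x) < \<epsilon>"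
    unfolding uniformly_continuous_on_def using \<epsilon> by metis
  define \<delta> where "\<delta> = min \<delta>0 1"
  have \<delta>: "0 < \<delta>" using \<delta>0 by (simp add: \<delta>_def)
  show thesis
  proof (rule that[of "2 * M / \<delta>\<^sup>2"])
    show "0 \<le> 2 * M / \<delta>\<^sup>2" using M by simp
    fix x t :: real assume x: "0 \<le> x" and t: "0 \<le> t"
    \<comment> \<open>Far apart, only the size of \<open>g\<close> matters, and \<open>2 M\<close> is absorbed because \<open>\<bar>t - x\<bar> \<ge> \<delta>\<close>.\<close>
    have glob: "\<bar>g s\<bar> \<le> \<epsilon> * rho s + M" if "0 \<le> s" for s
    proof (cases "A \<le> s")
      case True then show ?thesis using tail[of s] M by simp
    next
      case False
      moreover have "0 \<le> \<epsilon> * rho s" using \<epsilon> rho[of s] by simp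
      ultimately show ?thesis using M(2)[of s] that by simp
    qed
    have eps: "\<epsilon> \<le> \<epsilon> * rho s" for s
      using \<epsilon> rho[of s] by simp
    show "\<bar>g t - g x\<bar> \<le> \<epsilon> * (rho t + rho x) + 2 * M / \<delta>\<^sup>2 * (t - x)\<^sup>2"
    proof (cases "\<bar>t - x\<bar> < \<delta>")
      case True
      have "\<bar>g t - g x\<bar> \<le> \<epsilon> * (rho t + rho x)"
      proof (cases "A \<le> t \<and> A \<le> x")
        case True
        then show ?thesis using tail[of t] tail[of x] by (simp add: distrib_left)
      next
        \<comment> \<open>One of the points lies below \<open>A\<close>, and \<open>\<delta> \<le> 1\<close> keeps the other one below \<open>A + 1\<close>.\<close>
        case False
        then have "dist (g t) (g x) < \<epsilon>"
          using True x t by (intro \<delta>0(2)) (auto simp: \<delta>_def dist_real_def)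
        then show ?thesis using eps[of t] eps[of x] \<epsilon>
          unfolding dist_real_def distrib_left by linarith
      qed
      moreover have "0 \<le> 2 * M / \<delta>\<^sup>2 * (t - x)\<^sup>2" using M by simp
      ultimately show ?thesis by linarith
    next
      case False
      then have "\<delta>\<^sup>2 \<le> (t - x)\<^sup>2"
        using \<delta> power_mono[of \<delta> "\<bar>t - x\<bar>" 2] by simp
      then have "2 * M \<le> 2 * M / \<delta>\<^sup>2 * (t - x)\<^sup>2"
        using M \<delta> by (simp add: field_simps)
      then show ?thesis using glob[OF t] glob[OF x] by (simp add: distrib_left)
    qed
  qed
qed

section \<open>Convergence in the weighted norm\<close>

text \<open>The hypothesis compares \<open>f\<close> with a quadratic in \<open>t\<close> that takes the value \<open>f x\<close> at \<open>x\<close>. The factors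
  come from the bounds \<open>S \<le> 5 u \<rho>(x)\<close> for the error at \<open>t\<^sup>2\<close> and \<open>V \<le> 4 u \<rho>(x)\<close> for the mean of
  \<open>(t - x)\<^sup>2\<close>, where \<open>u = 1/(n + p)\<close>. The image of \<open>\<rho>\<close> is \<open>\<rho> + S\<close>, at most \<open>6 \<rho>(x)\<close>, whence the factor
  \<open>7\<close> for \<open>\<rho>(t) + \<rho>(x)\<close>.\<close>

lemma bss_operator_approximation_bound:
  fixes f :: "real \<Rightarrow> real"
  assumes m: "0 < n + p" and x: "0 \<le> x"
    and cont: "continuous_on {0..} f" and \<epsilon>: "0 \<le> \<epsilon>" and C: "0 \<le> C"
    and osc: "\<And>t. 0 \<le> t \<Longrightarrow> \<bar>f t - f x - l * (t\<^sup>2 - x\<^sup>2)\<bar> \<le> \<epsilon> * (rho t + rho x) + C * (t - x)\<^sup>2"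
  shows "\<bar>bss_operator n p f x - f x\<bar> \<le> (7 * \<epsilon> + (5 * \<bar>l\<bar> + 4 * C) / real (n + p)) * rho x"
proof -
  define u where "u = 1 / real (n + p)"
  have u: "0 < u" "u \<le> 1" using m by (auto simp: u_def)
  define S where "S = u * x\<^sup>2 + 4 * u * x + 2 * u\<^sup>2"
  define V where "V = u * x\<^sup>2 + 2 * u * x + 2 * u\<^sup>2"
  have usq: "u\<^sup>2 \<le> u" using u by (simp add: power2_eq_square mult_left_le)
  have "2 * x \<le> 1 + x\<^sup>2" using sum_squares_ge_zero[of "x - 1" 0] by (simp add: power2_eq_square algebra_simps)
  then have "u * (2 * x) \<le> u * (1 + x\<^sup>2)" using u by (intro mult_left_mono) auto
  then have ux: "2 * (u * x) \<le> u + u * x\<^sup>2" by (simp add: algebra_simps)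
  have rho: "u * rho x = u + u * x\<^sup>2" by (simp add: rho_def algebra_simps)
  have ux2: "0 \<le> u * x\<^sup>2" using u by simp
  have S0: "0 \<le> S" using u x by (simp add: S_def)
  have S: "S \<le> 5 * (u * rho x)"
    using ux ux2 usq u unfolding S_def rho mult.assoc distrib_left by linarith
  have V: "V \<le> 4 * (u * rho x)"
    using ux ux2 usq u unfolding V_def rho mult.assoc distrib_left by linarith
  have "u * rho x \<le> rho x" using u by (simp add: rho_def mult_left_le_one_le)
  then have S': "S \<le> 5 * rho x" using S by linarith
  \<comment> \<open>The coefficients of the right-hand side of \<open>osc\<close> as a polynomial in \<open>t\<close>.\<close>
  define a b c where "a = \<epsilon> * (1 + rho x) + C * x\<^sup>2" and "b = - 2 * C * x" and "c = \<epsilon> + C"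
  have "\<bar>f t - ((f x - l * x\<^sup>2) + 0 * t + l * t\<^sup>2)\<bar> \<le> a + b * t + c * t\<^sup>2" if "0 \<le> t" for t
    using osc[OF that] unfolding a_def b_def c_def
    by (simp add: rho_def power2_eq_square algebra_simps)
  from bss_operator_quadratic_comparison[OF m x cont this]
  have "\<bar>bss_operator n p f x - ((f x - l * x\<^sup>2) + l * (x\<^sup>2 + S))\<bar>
      \<le> a + b * (x + u) + c * (x\<^sup>2 + S)"
    unfolding bss_operator_quadratic[OF m x] S_def u_def by (simp add: power_one_over algebra_simps)
  also have "a + b * (x + u) + c * (x\<^sup>2 + S) = \<epsilon> * (2 * rho x + S) + C * V"
    by (simp add: a_def b_def c_def S_def V_def rho_def power2_eq_square algebra_simps)
  also have "\<dots> \<le> \<epsilon> * (7 * rho x) + C * (4 * (u * rho x))"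
    using S' V \<epsilon> C by (intro add_mono mult_left_mono) auto
  finally have "\<bar>bss_operator n p f x - f x - l * S\<bar> \<le> \<epsilon> * (7 * rho x) + C * (4 * (u * rho x))"
    by (simp add: algebra_simps)
  moreover have "\<bar>l * S\<bar> \<le> \<bar>l\<bar> * (5 * (u * rho x))"
    using S0 S by (auto simp: abs_mult intro!: mult_left_mono)
  ultimately have "\<bar>bss_operator n p f x - f x\<bar>
      \<le> \<epsilon> * (7 * rho x) + C * (4 * (u * rho x)) + \<bar>l\<bar> * (5 * (u * rho x))"
    by linarith
  also have "\<dots> = (7 * \<epsilon> + (5 * \<bar>l\<bar> + 4 * C) * u) * rho x"
    by (simp add: algebra_simps)
  finally show ?thesis by (simp add: u_def)
qed

text \<open>The lower bound needs the hypothesis too: without it the supremum could be unspecified.\<close>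

lemma rho_norm_bounds:
  assumes "\<And>x. 0 \<le> x \<Longrightarrow> \<bar>g x\<bar> \<le> K * rho x"
  shows "0 \<le> rho_norm g" and "rho_norm g \<le> K"
proof -
  have le: "\<bar>g x\<bar> / (1 + x\<^sup>2) \<le> K" if "0 \<le> x" for x
  proof -
    have "0 < 1 + x\<^sup>2" by (simp add: add_pos_nonneg)
    then show ?thesis using assms[OF that] by (simp add: rho_def pos_divide_le_eq)
  qed
  show "rho_norm g \<le> K"
    unfolding rho_norm_def by (rule cSUP_least) (auto intro: le)
  have "\<bar>g 0\<bar> / (1 + 0\<^sup>2) \<le> rho_norm g"
    unfolding rho_norm_def by (rule cSUP_upper) (auto intro!: bdd_aboveI2 le)
  then show "0 \<le> rho_norm g" by (rule order_trans[rotated]) simp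
qed

theorem theorem3:
  fixes p :: nat and f :: "real \<Rightarrow> real"
  assumes "p \<ge> 1" and "f \<in> C_rho_star"
  shows "(\<lambda>n. rho_norm (\<lambda>x. bss_operator n p f x - f x)) \<longlonglongrightarrow> 0"
proof -
  from assms(2) obtain l where cont: "continuous_on {0..} f"
    and lim: "((\<lambda>x. f x / rho x) \<longlongrightarrow> l) at_top"
    by (auto simp: C_rho_star_def C_rho_def)
  define g where "g = (\<lambda>t. f t - l * rho t)"
  have g_cont: "continuous_on {0..} g"
    unfolding g_def rho_def by (intro continuous_intros cont)
  have "g t / rho t = f t / rho t - l" for t
  proof -
    have "0 < rho t" by (simp add: rho_def add_pos_nonneg)
    then show ?thesis by (simp add: g_def diff_divide_distrib)
  qed
  then have g_lim: "((\<lambda>t. g t / rho t) \<longlongrightarrow> 0) at_top"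
    using lim by (simp add: LIM_zero)
  show ?thesis
  proof (rule LIMSEQ_I)
    fix r :: real assume r: "0 < r"
    \<comment> \<open>The oscillation parameter \<open>\<epsilon>\<close> enters the error bound with the factor 7.\<close>
    define \<epsilon> where "\<epsilon> = r / 14"
    have \<epsilon>: "0 < \<epsilon>" using r by (simp add: \<epsilon>_def)
    obtain C where C: "0 \<le> C"
      and osc: "\<And>x t. 0 \<le> x \<Longrightarrow> 0 \<le> t \<Longrightarrow> \<bar>g t - g x\<bar> \<le> \<epsilon> * (rho t + rho x) + C * (t - x)\<^sup>2"
      using rho_small_oscillation_bound[OF g_cont g_lim \<epsilon>] by blast
    have f_osc: "\<bar>f t - f x - l * (t\<^sup>2 - x\<^sup>2)\<bar> \<le> \<epsilon> * (rho t + rho x) + C * (t - x)\<^sup>2"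
      if "0 \<le> x" "0 \<le> t" for x t
    proof -
      have "f t - f x - l * (t\<^sup>2 - x\<^sup>2) = g t - g x"
        by (simp add: g_def rho_def algebra_simps)
      then show ?thesis using osc[OF that] by simp
    qed
    define D where "D = 5 * \<bar>l\<bar> + 4 * C"
    obtain N where N: "D / (r / 2) < real N" using reals_Archimedean2 by blast
    have "norm (rho_norm (\<lambda>x. bss_operator n p f x - f x) - 0) < r" if "N \<le> n" for n
    proof -
      have m: "0 < n + p" using assms(1) by simp
      have bound: "\<bar>bss_operator n p f x - f x\<bar> \<le> (7 * \<epsilon> + D / real (n + p)) * rho x"
        if "0 \<le> x" for x
        unfolding D_def
        using \<epsilon> by (intro bss_operator_approximation_bound m that cont C f_osc) auto
      have "D / (r / 2) < real (n + p)" using N that by simp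
      then have "D / real (n + p) < r / 2"
        using r m by (simp add: field_simps del: of_nat_add)
      then have "7 * \<epsilon> + D / real (n + p) < r" unfolding \<epsilon>_def by linarith
      then show ?thesis using rho_norm_bounds[OF bound] by simp
    qed
    then show "\<exists>N. \<forall>n\<ge>N. norm (rho_norm (\<lambda>x. bss_operator n p f x - f x) - 0) < r" by blast
  qed
qed

end
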